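(* Let $\gamma\ge1$, $\delta\ge0$, $\alpha>0$, $2\alpha+3\beta\ge0$. Then for the Cauchy problem (CP) there is no classical solution $(\rho,u)\in D(\infty)$ with $$\limsup_{t\to+\infty}\|u(t,\cdot)\|_{L^\infty(\mathbb{R}^3)}=0.$$
   Context: The Cauchy problem (CP): for the density $\rho\ge0$ and the velocity $u\in\mathbb{R}^3$, $$\rho_t+\mathrm{div}(\rho u)=0,\qquad (\rho u)_t+\mathrm{div}(\rho u\otimes u)+\nabla P=\mathrm{div}\,\mathbb{T},$$ with $P=A\rho^\gamma$, $A>0$ constant, $\mathbb{T}=\alpha\rho^\delta(\nabla u+(\nabla u)^\top)+\beta\rho^\delta\,\mathrm{div}u\,\mathbb{I}_3$ ($\alpha,\beta$ constants, $\mathbb{I}_3$ the $3\times3$ identity), with initial data $(\rho,u)|_{t=0}=(\rho_0(x)\ge0,u_0(x))$ for $x\in\mathbb{R}^3$, and far field behavior $(\rho,u)(t,x)\to(0,0)$ as $|x|\to\infty$ for $t\ge0$. Define $$m(t)=\int_{\mathbb{R}^3}\rho(t,x)\,dx,\quad \mathbb{P}(t)=\int_{\mathbb{R}^3}\rho(t,x)u(t,x)\,dx,\quad E_k(t)=\frac12\int_{\mathbb{R}^3}\rho(t,x)|u(t,x)|^2\,dx$$ (total mass, momentum, total kinetic energy). For $T>0$, a classical solution $(\rho,u)$ to (CP) is said to be in $D(T)$ if: (A) (conservation of total mass) $0<m(0)=m(t)<\infty$ for any $t\in[0,T]$; (B) (conservation of momentum) $0<|\mathbb{P}(0)|=|\mathbb{P}(t)|<+\infty$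 for any $t\in[0,T]$; (C) (finite kinetic energy) $0<E_k(t)<\infty$ for any $t\in[0,T]$. $(\rho,u)\in D(\infty)$ means that the solution is defined for all times $t\ge0$ and is in $D(T)$ for every $T>0$. *)

theory Defs
  imports "HOL-Probability.Essential_Supremum"
begin

text \<open>
  The density is a function \<open>\<rho> :: real \<Rightarrow> real ^ 3 \<Rightarrow> real\<close> and the velocity a function
  \<open>u :: real \<Rightarrow> real ^ 3 \<Rightarrow> real ^ 3\<close> of time and space. Both are total functions; only their values
  at times in \<open>{0..T}\<close> are constrained below.
\<close>

section \<open>Differential operators\<close>

definition C1_on :: "('a::real_normed_vector \<Rightarrow> 'b::real_normed_vector) \<Rightarrow> 'a set \<Rightarrow> bool" where
  "C1_on f S \<longleftrightarrow> (\<exists>f' :: 'a \<Rightarrow> 'a \<Rightarrow>\<^sub>L 'b.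
     (\<forall>p\<in>S. (f has_derivative blinfun_apply (f' p)) (at p)) \<and> continuous_on S f')"

definition time_deriv :: "(real \<Rightarrow> real ^ 3 \<Rightarrow> 'b::real_normed_vector) \<Rightarrow> real \<Rightarrow> real ^ 3 \<Rightarrow> 'b" where
  "time_deriv f t x = vector_derivative (\<lambda>s. f s x) (at t)"

definition partial :: "3 \<Rightarrow> (real ^ 3 \<Rightarrow> real) \<Rightarrow> real ^ 3 \<Rightarrow> real" where
  "partial j f x = frechet_derivative f (at x) (axis j 1)"

definition grad :: "(real ^ 3 \<Rightarrow> real) \<Rightarrow> real ^ 3 \<Rightarrow> real ^ 3" where
  "grad f x = (\<chi> j. partial j f x)"

definition grad_vec :: "(real ^ 3 \<Rightarrow> real ^ 3) \<Rightarrow> real ^ 3 \<Rightarrow> real ^ 3 ^ 3" where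
  "grad_vec v x = (\<chi> i j. partial j (\<lambda>y. v y $ i) x)"

definition div_vec :: "(real ^ 3 \<Rightarrow> real ^ 3) \<Rightarrow> real ^ 3 \<Rightarrow> real" where
  "div_vec v x = (\<Sum>j\<in>UNIV. partial j (\<lambda>y. v y $ j) x)"

text \<open>The divergence of a matrix field is taken row by row.\<close>

definition div_mat :: "(real ^ 3 \<Rightarrow> real ^ 3 ^ 3) \<Rightarrow> real ^ 3 \<Rightarrow> real ^ 3" where
  "div_mat M x = (\<chi> i. div_vec (\<lambda>y. M y $ i) x)"

definition tensor :: "real ^ 3 \<Rightarrow> real ^ 3 \<Rightarrow> real ^ 3 ^ 3" where
  "tensor a b = (\<chi> i j. a $ i * b $ j)"

section \<open>The Cauchy problem\<close>

text \<open>
  For \<open>\<delta> = 0\<close> the factor \<open>\<rho>\<^sup>\<delta>\<close> is identically 1 (constant viscosity), also where \<open>\<rho> = 0\<close>, whereas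
  \<^term>\<open>0 powr 0 = (0::real)\<close> in the library.
\<close>

definition visc_power :: "real \<Rightarrow> real \<Rightarrow> real" where
  "visc_power \<delta> r = (if \<delta> = 0 then 1 else r powr \<delta>)"

definition pressure :: "real \<Rightarrow> real \<Rightarrow> real \<Rightarrow> real" where
  "pressure A \<gamma> r = A * r powr \<gamma>"

definition viscous_stress ::
  "real \<Rightarrow> real \<Rightarrow> real \<Rightarrow> (real ^ 3 \<Rightarrow> real) \<Rightarrow> (real ^ 3 \<Rightarrow> real ^ 3) \<Rightarrow> real ^ 3 \<Rightarrow> real ^ 3 ^ 3" where
  "viscous_stress \<delta> \<alpha> \<beta> r v x =
     (\<alpha> * visc_power \<delta> (r x)) *\<^sub>R (grad_vec v x + transpose (grad_vec v x))
     + (\<beta> * visc_power \<delta> (r x) * div_vec v x) *\<^sub>R mat 1"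

text \<open>
  A solution on \<open>[0, T]\<close> is classical if it is continuous up to the initial time and the derivatives
  occurring in the system exist and are continuous for \<open>0 < t < T\<close>. Differentiability of the viscous
  stress is a separate requirement: for \<open>\<delta> < 1\<close> the power \<open>\<rho>\<^sup>\<delta>\<close> need not be differentiable at the
  boundary of the vacuum. No such requirement is needed for the pressure, as \<open>\<gamma> \<ge> 1\<close>.
\<close>

definition classical_solution ::
  "real \<Rightarrow> real \<Rightarrow> real \<Rightarrow> real \<Rightarrow> real \<Rightarrow> (real ^ 3 \<Rightarrow> real) \<Rightarrow> (real ^ 3 \<Rightarrow> real ^ 3) \<Rightarrow> real \<Rightarrow>
   (real \<Rightarrow> real ^ 3 \<Rightarrow> real) \<Rightarrow> (real \<Rightarrow> real ^ 3 \<Rightarrow> real ^ 3) \<Rightarrow> bool" where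
  "classical_solution A \<gamma> \<delta> \<alpha> \<beta> \<rho>0 u0 T \<rho> u \<longleftrightarrow>
     \<comment> \<open>regularity\<close>
     continuous_on ({0..T} \<times> UNIV) (\<lambda>(t, x). \<rho> t x) \<and>
     continuous_on ({0..T} \<times> UNIV) (\<lambda>(t, x). u t x) \<and>
     C1_on (\<lambda>(t, x). \<rho> t x) ({0<..<T} \<times> UNIV) \<and>
     C1_on (\<lambda>(t, x). u t x) ({0<..<T} \<times> UNIV) \<and>
     (\<exists>S' :: real \<times> (real ^ 3) \<Rightarrow> ((real ^ 3) \<Rightarrow>\<^sub>L (real ^ 3 ^ 3)).
        (\<forall>t\<in>{0<..<T}. \<forall>x.
           (viscous_stress \<delta> \<alpha> \<beta> (\<rho> t) (u t) has_derivative blinfun_apply (S' (t, x))) (at x)) \<and>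
        continuous_on ({0<..<T} \<times> UNIV) S') \<and>
     (\<forall>t\<in>{0..T}. \<forall>x. 0 \<le> \<rho> t x) \<and>
     \<comment> \<open>equations\<close>
     (\<forall>t\<in>{0<..<T}. \<forall>x.
        time_deriv \<rho> t x + div_vec (\<lambda>y. \<rho> t y *\<^sub>R u t y) x = 0) \<and>
     (\<forall>t\<in>{0<..<T}. \<forall>x.
        time_deriv (\<lambda>s y. \<rho> s y *\<^sub>R u s y) t x
        + div_mat (\<lambda>y. \<rho> t y *\<^sub>R tensor (u t y) (u t y)) x
        + grad (\<lambda>y. pressure A \<gamma> (\<rho> t y)) x
        = div_mat (viscous_stress \<delta> \<alpha> \<beta> (\<rho> t) (u t)) x) \<and>
     \<comment> \<open>initial data and far field\<close>
     (\<forall>x. \<rho> 0 x = \<rho>0 x \<and> u 0 x = u0 x) \<and>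
     (\<forall>t\<in>{0..T}. ((\<lambda>x. (\<rho> t x, u t x)) \<longlongrightarrow> (0, 0)) at_infinity)"

section \<open>Mass, momentum, kinetic energy\<close>

definition mass :: "(real ^ 3 \<Rightarrow> real) \<Rightarrow> ennreal" where
  "mass r = (\<integral>\<^sup>+x. ennreal (r x) \<partial>lborel)"

definition momentum :: "(real ^ 3 \<Rightarrow> real) \<Rightarrow> (real ^ 3 \<Rightarrow> real ^ 3) \<Rightarrow> real ^ 3" where
  "momentum r v = (\<integral>x. r x *\<^sub>R v x \<partial>lborel)"

definition kinetic_energy :: "(real ^ 3 \<Rightarrow> real) \<Rightarrow> (real ^ 3 \<Rightarrow> real ^ 3) \<Rightarrow> ennreal" where
  "kinetic_energy r v = (\<integral>\<^sup>+x. ennreal (r x * (norm (v x))\<^sup>2) \<partial>lborel) / 2"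

text \<open>
  Finiteness of the momentum is expressed by integrability, since the Bochner integral of a
  non-integrable function is 0 by convention.
\<close>

definition D ::
  "real \<Rightarrow> real \<Rightarrow> real \<Rightarrow> real \<Rightarrow> real \<Rightarrow> (real ^ 3 \<Rightarrow> real) \<Rightarrow> (real ^ 3 \<Rightarrow> real ^ 3) \<Rightarrow> real \<Rightarrow>
   ((real \<Rightarrow> real ^ 3 \<Rightarrow> real) \<times> (real \<Rightarrow> real ^ 3 \<Rightarrow> real ^ 3)) set" where
  "D A \<gamma> \<delta> \<alpha> \<beta> \<rho>0 u0 T = {(\<rho>, u).
     classical_solution A \<gamma> \<delta> \<alpha> \<beta> \<rho>0 u0 T \<rho> u \<and>
     (\<forall>t\<in>{0..T}. 0 < mass (\<rho> 0) \<and> mass (\<rho> 0) = mass (\<rho> t) \<and> mass (\<rho> t) < \<infinity>) \<and>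
     (\<forall>t\<in>{0..T}. integrable lborel (\<lambda>x. \<rho> t x *\<^sub>R u t x) \<and>
        0 < norm (momentum (\<rho> 0) (u 0)) \<and>
        norm (momentum (\<rho> 0) (u 0)) = norm (momentum (\<rho> t) (u t))) \<and>
     (\<forall>t\<in>{0..T}. 0 < kinetic_energy (\<rho> t) (u t) \<and> kinetic_energy (\<rho> t) (u t) < \<infinity>)}"

definition D_infinity ::
  "real \<Rightarrow> real \<Rightarrow> real \<Rightarrow> real \<Rightarrow> real \<Rightarrow> (real ^ 3 \<Rightarrow> real) \<Rightarrow> (real ^ 3 \<Rightarrow> real ^ 3) \<Rightarrow>
   ((real \<Rightarrow> real ^ 3 \<Rightarrow> real) \<times> (real \<Rightarrow> real ^ 3 \<Rightarrow> real ^ 3)) set" where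
  "D_infinity A \<gamma> \<delta> \<alpha> \<beta> \<rho>0 u0 = (\<Inter>T\<in>{0<..}. D A \<gamma> \<delta> \<alpha> \<beta> \<rho>0 u0 T)"

definition Linf_norm :: "(real ^ 3 \<Rightarrow> real ^ 3) \<Rightarrow> ennreal" where
  "Linf_norm v = esssup lborel (\<lambda>x. ennreal (norm (v x)))"

end

theory Submission
  imports Defs
begin

text \<open>
  The estimate \<open>\<bar>\<integral> \<rho> u\<bar> \<le> \<parallel>u\<parallel>\<^sub>\<infinity> \<integral> \<rho>\<close> and the conservation of mass and momentum bound
  \<open>\<parallel>u(t)\<parallel>\<^sub>\<infinity>\<close> from below by the constant \<open>\<bar>P(0)\<bar> / m(0) > 0\<close>.
\<close>

lemma norm_momentum_le:
  assumes r: "r \<in> borel_measurable borel" and "\<And>x. 0 \<le> r x"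
  shows "ennreal (norm (momentum r v)) \<le> Linf_norm v * mass r"
proof (cases "integrable lborel (\<lambda>x. r x *\<^sub>R v x)")
  case True
  have "ennreal (norm (momentum r v)) \<le> (\<integral>\<^sup>+x. ennreal (norm (r x *\<^sub>R v x)) \<partial>lborel)"
    unfolding momentum_def using integral_norm_bound_ennreal[OF True] by simp
  also have "\<dots> = (\<integral>\<^sup>+x. ennreal (norm (v x)) * ennreal (r x) \<partial>lborel)"
    using assms(2) by (simp add: ennreal_mult'' mult.commute)
  \<comment> \<open>The essential supremum bounds \<open>norm (v x)\<close> only almost everywhere.
    For non-measurable \<open>v\<close> it is \<open>top\<close>, so the bound persists.\<close>
  also have "\<dots> \<le> (\<integral>\<^sup>+x. Linf_norm v * ennreal (r x) \<partial>lborel)"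
    unfolding Linf_norm_def
    using esssup_AE[of "\<lambda>x. ennreal (norm (v x))" lborel]
    by (intro nn_integral_mono_AE) (auto elim!: eventually_mono intro: mult_right_mono)
  also have "\<dots> = Linf_norm v * mass r"
    unfolding mass_def using r by (intro nn_integral_cmult) simp
  finally show ?thesis .
next
  case False
  \<comment> \<open>Here the Bochner integral takes its default value 0, so the left side
    vanishes.\<close>
  then show ?thesis by (simp add: momentum_def not_integrable_integral_eq)
qed

theorem theorem1p3:
  fixes A \<gamma> \<delta> \<alpha> \<beta> :: real
    and \<rho>0 :: "real ^ 3 \<Rightarrow> real" and u0 :: "real ^ 3 \<Rightarrow> real ^ 3"
  assumes "A > 0" and "\<gamma> \<ge> 1" and "\<delta> \<ge> 0" and "\<alpha> > 0" and "2 * \<alpha> + 3 * \<beta> \<ge> 0"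
    and "\<forall>x. \<rho>0 x \<ge> 0"
  shows "\<not> (\<exists>\<rho> u. (\<rho>, u) \<in> D_infinity A \<gamma> \<delta> \<alpha> \<beta> \<rho>0 u0 \<and>
                   Limsup at_top (\<lambda>t. Linf_norm (u t)) = 0)"
proof
  assume "\<exists>\<rho> u. (\<rho>, u) \<in> D_infinity A \<gamma> \<delta> \<alpha> \<beta> \<rho>0 u0 \<and>
                Limsup at_top (\<lambda>t. Linf_norm (u t)) = 0"
  then obtain \<rho> u where sol: "\<And>T. T > 0 \<Longrightarrow> (\<rho>, u) \<in> D A \<gamma> \<delta> \<alpha> \<beta> \<rho>0 u0 T"
    and lim: "Limsup at_top (\<lambda>t. Linf_norm (u t)) = 0"
    by (auto simp: D_infinity_def)
  define c where "c = ennreal (norm (momentum (\<rho> 0) (u 0))) / mass (\<rho> 0)"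
  have m0: "0 < mass (\<rho> 0)" "mass (\<rho> 0) < \<infinity>" and p0: "0 < norm (momentum (\<rho> 0) (u 0))"
    using sol[of 1] by (auto simp: D_def dest!: bspec[of _ _ 0])
  \<comment> \<open>The time horizon is \<open>t\<close> itself, which makes \<open>t\<close> the
    right endpoint of the closed interval on which the conservation laws hold.\<close>
  have "c \<le> Linf_norm (u t)" if "t > 0" for t
  proof -
    have cont: "continuous_on ({0..t} \<times> UNIV) (\<lambda>(t, x). \<rho> t x)"
      and nonneg: "\<And>x. 0 \<le> \<rho> t x"
      and mass: "mass (\<rho> 0) = mass (\<rho> t)"
      and mom: "norm (momentum (\<rho> 0) (u 0)) = norm (momentum (\<rho> t) (u t))"
      using sol[OF that] that by (auto simp: D_def classical_solution_def)
    \<comment> \<open>Joint continuity is restricted to the slice at time \<open>t\<close>, to get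
      the measurability of the density.\<close>
    have "continuous_on UNIV (\<lambda>x. (\<lambda>(t, x). \<rho> t x) (t, x))"
      by (rule continuous_on_compose2[OF cont]) (use that in \<open>auto intro!: continuous_intros\<close>)
    then have "\<rho> t \<in> borel_measurable borel"
      by (intro borel_measurable_continuous_onI) simp
    from norm_momentum_le[OF this nonneg, of "u t"]
    have "ennreal (norm (momentum (\<rho> 0) (u 0))) \<le> mass (\<rho> 0) * Linf_norm (u t)"
      by (simp add: mass mom mult.commute)
    then show ?thesis
      unfolding c_def using m0 by (intro divide_le_posI_ennreal)
  qed
  \<comment> \<open>A bound for all positive times already holds for the lower limit, which the
    upper limit dominates.\<close>
  then have "c \<le> Limsup at_top (\<lambda>t. Linf_norm (u t))"
    by (intro order_trans[OF _ Liminf_le_Limsup] Liminf_bounded)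
      (auto intro: eventually_mono[OF eventually_gt_at_top[of 0]])
  \<comment> \<open>Finiteness of the mass matters here: in \<open>ennreal\<close> a quotient by
    infinity would be 0.\<close>
  moreover have "0 < c"
    unfolding c_def using m0 p0 by (simp add: ennreal_zero_less_divide)
  ultimately show False using lim by simp
qed

end
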